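(* Let $B$ be a discrete abelian group, $\alpha\in\mathrm{Aut}(B)$, $K=\hat B$, $G=B\rtimes_\alpha\mathbb{Z}$. Let $\chi\in K$ be an element of finite period $p$, i.e. $\hat\alpha^p\chi=\chi$ and $\hat\alpha^k\chi\neq\chi$ for $1\le k<p$, and let $U_p^{(\chi)}$ be the associated $p$-dimensional irreducible representation of $G$ on $\mathbb{C}^p$. Then $$\mathcal{L}_G\big(U_p^{(\chi)},\mathrm{Ind}_B^G(\chi)\big)=\{0\}.$$
   Context: $K=\hat B$ is the compact Pontryagin dual of $B$; $(\hat\alpha\chi)(b)=\chi(\alpha(b))$. The group $G=B\rtimes_\alpha\mathbb{Z}$ is $\mathbb{Z}\times B$ with product $(j,b)(k,c)=(j+k,\alpha^j(c)+b)$. For $\chi$ of minimal period $p$, $U_p^{(\chi)}(j,b)=D_\chi^{(p)}(b)\,(T^{(p)})^j$ for $(j,b)\in G$, where $D_\chi^{(p)}(b)$ is the $p\times p$ diagonal matrix with diagonal entries $\chi(b),\chi(\alpha(b)),\dots,\chi(\alpha^{p-1}(b))$, and $T^{(p)}$ is the $p\times p$ cyclic permutation matrix given by $(T^{(p)}\xi)_k=\xi_{k+1}$, indices $k\in\{0,\dots,p-1\}$ taken modulo $p$. $\mathrm{Ind}_B^G(\chi)$ acts on the Hilbert space $\mathcal{H}(\chi)$ of functions $F:G\to\mathbb{C}$ with $F(j,b)=\chi(b)F(j,0)$ and $\|F\|_\chi^2=\sum_{j\in\mathbb{Z}}|F(j,0)|^2<\infty$, by $(\mathrm{Ind}_B^G(\chi)(g_1)F)(g_2)=F(g_2g_1)$.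 For unitary representations $U_i$ of $G$ on Hilbert spaces $\mathcal{H}_i$, $i=1,2$, $\mathcal{L}_G(U_1,U_2)$ is the set of bounded linear $A:\mathcal{H}_1\to\mathcal{H}_2$ with $AU_1(g)=U_2(g)A$ for all $g\in G$. *)

theory Defs
  imports
    "HOL-Algebra.Group"
    "HOL-Analysis.Infinite_Sum"
    "Jordan_Normal_Form.Determinant"
begin

section \<open>The group and the dual action\<close>

text \<open>
  The discrete abelian group \<open>B\<close> is an arbitrary type of class \<^class>\<open>ab_group_add\<close>; discreteness
  means that characters are subject to no continuity condition.
\<close>

definition automorphism :: "('b::ab_group_add \<Rightarrow> 'b) \<Rightarrow> bool" where
  "automorphism \<alpha> \<longleftrightarrow> bij \<alpha> \<and> (\<forall>b c. \<alpha> (b + c) = \<alpha> b + \<alpha> c)"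

definition int_iter :: "('b \<Rightarrow> 'b) \<Rightarrow> int \<Rightarrow> 'b \<Rightarrow> 'b" where
  "int_iter \<alpha> j = (if 0 \<le> j then \<alpha> ^^ nat j else (inv_into UNIV \<alpha>) ^^ nat (- j))"

definition semidirect_int :: "('b::ab_group_add \<Rightarrow> 'b) \<Rightarrow> (int \<times> 'b) monoid" where
  "semidirect_int \<alpha> =
    \<lparr>carrier = UNIV,
     mult = (\<lambda>(j, b) (k, c). (j + k, int_iter \<alpha> j c + b)),
     one = (0, 0)\<rparr>"

lemma int_iter_add:
  assumes "bij \<alpha>"
  shows "int_iter \<alpha> (j + k) b = int_iter \<alpha> j (int_iter \<alpha> k b)"
proof -
  let ?\<beta> = "inv_into UNIV \<alpha>"
  have ab: "\<alpha> (?\<beta> x) = x" for x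
    using assms by (simp add: bij_is_surj surj_f_inv_f)
  have ba: "?\<beta> (\<alpha> x) = x" for x
    using assms by (simp add: bij_is_inj)
  have suc: "int_iter \<alpha> (i + 1) x = \<alpha> (int_iter \<alpha> i x)" for i x
  proof (cases "0 \<le> i")
    case True
    then show ?thesis by (simp add: int_iter_def nat_add_distrib)
  next
    case False
    then obtain n where n: "i = - int (Suc n)"
      by (metis int_cases not_le of_nat_0_le_iff)
    then have eq: "nat (- (i + 1)) = n" "nat (- i) = Suc n" by auto
    show ?thesis
      using False eq by (cases "n = 0") (auto simp: int_iter_def ab n)
  qed
  have pre: "int_iter \<alpha> (i - 1) x = ?\<beta> (int_iter \<alpha> i x)" for i x
    using suc[of "i - 1" x] by (simp add: ba)
  show ?thesis
  proof (induction j rule: int_induct[where k = 0])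
    case base
    show ?case by (simp add: int_iter_def)
  next
    case (step1 i)
    then show ?case using suc[of "i + k" b] suc[of i] by (simp add: algebra_simps)
  next
    case (step2 i)
    then show ?case using pre[of "i + k" b] pre[of i] by (simp add: algebra_simps)
  qed
qed

lemma int_iter_hom:
  assumes "automorphism \<alpha>"
  shows "int_iter \<alpha> j (b + c) = int_iter \<alpha> j b + int_iter \<alpha> j c"
proof -
  let ?\<beta> = "inv_into UNIV \<alpha>"
  have bij: "bij \<alpha>" and hom: "\<alpha> (x + y) = \<alpha> x + \<alpha> y" for x y
    using assms by (auto simp: automorphism_def)
  have "?\<beta> (x + y) = ?\<beta> x + ?\<beta> y" for x y
    by (metis bij bij_inv_eq_iff hom)
  then have "(?\<beta> ^^ n) (x + y) = (?\<beta> ^^ n) x + (?\<beta> ^^ n) y" for n x y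
    by (induction n) auto
  moreover have "(\<alpha> ^^ n) (x + y) = (\<alpha> ^^ n) x + (\<alpha> ^^ n) y" for n x y
    by (induction n) (auto simp: hom)
  ultimately show ?thesis by (simp add: int_iter_def)
qed

lemma group_semidirect_int:
  assumes "automorphism \<alpha>"
  shows "group (semidirect_int \<alpha>)"
proof -
  have bij: "bij \<alpha>" using assms by (simp add: automorphism_def)
  have id: "int_iter \<alpha> 0 b = b" for b by (simp add: int_iter_def)
  have zero: "int_iter \<alpha> j 0 = 0" for j
    using int_iter_hom[OF assms, of j 0 0] by simp
  have linv: "\<exists>j'. j' + j = 0 \<and> (\<exists>b'. int_iter \<alpha> j' b + b' = 0)" for j :: int and b
    by (rule exI[of _ "- j"]) (auto intro: exI[of _ "- int_iter \<alpha> (- j) b"])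
  show ?thesis
    by (rule groupI)
      (auto simp: semidirect_int_def id zero int_iter_add[OF bij] int_iter_hom[OF assms]
         add.assoc linv)
qed

definition characters :: "('b::ab_group_add \<Rightarrow> complex) set" where
  "characters = {\<chi>. (\<forall>b. cmod (\<chi> b) = 1) \<and> (\<forall>b c. \<chi> (b + c) = \<chi> b * \<chi> c)}"

definition dual_aut :: "('b \<Rightarrow> 'b) \<Rightarrow> ('b \<Rightarrow> complex) \<Rightarrow> 'b \<Rightarrow> complex" where
  "dual_aut \<alpha> \<chi> = (\<lambda>b. \<chi> (\<alpha> b))"

definition minimal_period :: "('b \<Rightarrow> 'b) \<Rightarrow> ('b \<Rightarrow> complex) \<Rightarrow> nat \<Rightarrow> bool" where
  "minimal_period \<alpha> \<chi> p \<longleftrightarrow>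
     1 \<le> p \<and> (dual_aut \<alpha> ^^ p) \<chi> = \<chi> \<and> (\<forall>k. 1 \<le> k \<and> k < p \<longrightarrow> (dual_aut \<alpha> ^^ k) \<chi> \<noteq> \<chi>)"


section \<open>Normed spaces and intertwining operators\<close>

text \<open>
  The space of the induced representation depends on the character, and the dimension of the
  finite-dimensional one on \<open>p\<close>, so both are given by explicit carriers. Only the norm is recorded,
  as it determines the inner product by polarization.
\<close>

record 'v normed_space = "'v partial_object" +
  vzero :: 'v
  vadd :: "'v \<Rightarrow> 'v \<Rightarrow> 'v"
  vscale :: "complex \<Rightarrow> 'v \<Rightarrow> 'v"
  vnorm :: "'v \<Rightarrow> real"

definition bounded_linear_ops :: "'v normed_space \<Rightarrow> 'w normed_space \<Rightarrow> ('v \<Rightarrow> 'w) set" where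
  "bounded_linear_ops V W =
    {A. A \<in> carrier V \<rightarrow>\<^sub>E carrier W
      \<and> (\<forall>x\<in>carrier V. \<forall>y\<in>carrier V. A (vadd V x y) = vadd W (A x) (A y))
      \<and> (\<forall>c. \<forall>x\<in>carrier V. A (vscale V c x) = vscale W c (A x))
      \<and> (\<exists>C. \<forall>x\<in>carrier V. vnorm W (A x) \<le> C * vnorm V x)}"

definition zero_op :: "'v normed_space \<Rightarrow> 'w normed_space \<Rightarrow> 'v \<Rightarrow> 'w" where
  "zero_op V W = (\<lambda>x\<in>carrier V. vzero W)"

definition intertwiners ::
  "'g monoid \<Rightarrow> 'v normed_space \<Rightarrow> ('g \<Rightarrow> 'v \<Rightarrow> 'v) \<Rightarrow> 'w normed_space \<Rightarrow> ('g \<Rightarrow> 'w \<Rightarrow> 'w)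
    \<Rightarrow> ('v \<Rightarrow> 'w) set" where
  "intertwiners G V U\<^sub>1 W U\<^sub>2 =
    {A \<in> bounded_linear_ops V W. \<forall>g\<in>carrier G. \<forall>x\<in>carrier V. A (U\<^sub>1 g x) = U\<^sub>2 g (A x)}"


section \<open>The finite-dimensional representation\<close>

definition complex_space :: "nat \<Rightarrow> complex vec normed_space" where
  "complex_space p =
    \<lparr>carrier = carrier_vec p,
     vzero = 0\<^sub>v p,
     vadd = (+),
     vscale = (\<cdot>\<^sub>v),
     vnorm = (\<lambda>\<xi>. sqrt (\<Sum>k<p. (cmod (vec_index \<xi> k))\<^sup>2))\<rparr>"

definition diag_rep :: "('b \<Rightarrow> 'b) \<Rightarrow> ('b \<Rightarrow> complex) \<Rightarrow> nat \<Rightarrow> 'b \<Rightarrow> complex mat" where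
  "diag_rep \<alpha> \<chi> p b = mat_diag p (\<lambda>k. \<chi> ((\<alpha> ^^ k) b))"

definition cyclic_mat :: "nat \<Rightarrow> complex mat" where
  "cyclic_mat p = Matrix.mat p p (\<lambda>(k, l). if l = (k + 1) mod p then 1 else 0)"

text \<open>The power is the integer power in the monoid of \<open>p \<times> p\<close> matrices, as \<open>j\<close> may be negative.\<close>

lemma cyclic_mat_unit:
  assumes "1 \<le> p"
  shows "cyclic_mat p \<in> Units (ring_mat TYPE(complex) p ())"
proof -
  let ?T = "cyclic_mat p"
  have inj: "k = l" if "(k + 1) mod p = (l + 1) mod p" "k < p" "l < p" for k l
    using that by (auto simp: mod_Suc split: if_splits)
  have T: "?T \<in> carrier_mat p p" by (simp add: cyclic_mat_def)
  have sum: "(\<Sum>m\<in>{0..<p}. (if m = a then 1 else 0) * (if m = b then 1 else 0)) =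
      (if a = b then 1 else (0::complex))" if "a < p" for a b
  proof -
    have "(\<Sum>m\<in>{0..<p}. (if m = a then 1 else 0) * (if m = b then 1 else 0)) =
        (\<Sum>m\<in>{0..<p}. if m = a then (if a = b then 1 else (0::complex)) else 0)"
      by (rule sum.cong) simp_all
    also have "\<dots> = (if a = b then 1 else 0)"
      using that by simp
    finally show ?thesis .
  qed
  have right: "?T * transpose_mat ?T = 1\<^sub>m p"
  proof (rule eq_matI)
    fix k l assume "k < dim_row (1\<^sub>m p :: complex mat)" "l < dim_col (1\<^sub>m p :: complex mat)"
    then have kl: "k < p" "l < p" by simp_all
    have iff: "(k + 1) mod p = (l + 1) mod p \<longleftrightarrow> k = l"
      using inj[OF _ kl] by blast
    have "(?T * transpose_mat ?T) $$ (k, l) =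
        (\<Sum>m\<in>{0..<p}. (if m = (k + 1) mod p then 1 else 0) * (if m = (l + 1) mod p then 1 else 0))"
      using kl by (simp add: cyclic_mat_def scalar_prod_def)
    also have "\<dots> = (if (k + 1) mod p = (l + 1) mod p then 1 else 0)"
      using assms by (intro sum) simp
    also have "\<dots> = 1\<^sub>m p $$ (k, l)"
      unfolding iff using kl by simp
    finally show "(?T * transpose_mat ?T) $$ (k, l) = 1\<^sub>m p $$ (k, l)" .
  qed (simp_all add: cyclic_mat_def)
  have left: "transpose_mat ?T * ?T = 1\<^sub>m p"
    by (rule mat_mult_left_right_inverse[OF T _ right]) (simp add: T)
  have "transpose_mat ?T \<in> carrier_mat p p"
    using T by simp
  then show ?thesis
    using T left right unfolding Units_def ring_mat_simps by blast
qed

definition fin_rep_mat ::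
  "('b \<Rightarrow> 'b) \<Rightarrow> ('b \<Rightarrow> complex) \<Rightarrow> nat \<Rightarrow> int \<times> 'b \<Rightarrow> complex mat" where
  "fin_rep_mat \<alpha> \<chi> p = (\<lambda>(j, b).
     diag_rep \<alpha> \<chi> p b * (cyclic_mat p [^]\<^bsub>ring_mat TYPE(complex) p ()\<^esub> j))"

definition fin_rep ::
  "('b \<Rightarrow> 'b) \<Rightarrow> ('b \<Rightarrow> complex) \<Rightarrow> nat \<Rightarrow> int \<times> 'b \<Rightarrow> complex vec \<Rightarrow> complex vec" where
  "fin_rep \<alpha> \<chi> p g \<xi> = fin_rep_mat \<alpha> \<chi> p g *\<^sub>v \<xi>"


section \<open>The induced representation\<close>

definition ind_space :: "('b::ab_group_add \<Rightarrow> complex) \<Rightarrow> (int \<times> 'b \<Rightarrow> complex) normed_space" where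
  "ind_space \<chi> =
    \<lparr>carrier = {F. (\<forall>j b. F (j, b) = \<chi> b * F (j, 0))
                  \<and> (\<lambda>j. (cmod (F (j, 0)))\<^sup>2) summable_on UNIV},
     vzero = (\<lambda>_. 0),
     vadd = (\<lambda>F H g. F g + H g),
     vscale = (\<lambda>c F g. c * F g),
     vnorm = (\<lambda>F. sqrt (\<Sum>\<^sub>\<infinity>j\<in>UNIV. (cmod (F (j, 0)))\<^sup>2))\<rparr>"

definition ind_rep ::
  "('b::ab_group_add \<Rightarrow> 'b) \<Rightarrow> int \<times> 'b \<Rightarrow> (int \<times> 'b \<Rightarrow> complex) \<Rightarrow> int \<times> 'b \<Rightarrow> complex" where
  "ind_rep \<alpha> g\<^sub>1 F = (\<lambda>g\<^sub>2. F (g\<^sub>2 \<otimes>\<^bsub>semidirect_int \<alpha>\<^esub> g\<^sub>1))"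

end

theory Submission
  imports Defs "HOL-Algebra.Multiplicative_Group"
begin

text \<open>
  The reason is that the finite-dimensional representation sees only the class of \<open>j\<close> modulo \<open>p\<close>,
  whereas the induced one acts by shifts on square-summable sequences over \<open>\<int>\<close>. The cyclic matrix
  has order dividing \<open>p\<close>, so the group element \<open>(p, 0)\<close> acts as the identity on \<open>\<complex>\<^sup>p\<close>
  (\<open>fin_rep_period\<close>). On the induced space the same element acts as the translation
  \<open>F (j, b) \<mapsto> F (j + p, b)\<close> (\<open>ind_rep_translation\<close>). Any intertwiner therefore takes values in
  the functions \<open>F\<close> for which \<open>j \<mapsto> F (j, 0)\<close> is periodic, and a periodic sequence with a
  nonzero value repeats it infinitely often, so that it cannot be square-summable
  (\<open>periodic_summable_imp_zero\<close>). Hence \<open>F (j, 0) = 0\<close> for all \<open>j\<close>, and by covariance \<open>F = 0\<close>.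
\<close>

lemma periodic_summable_imp_zero:
  fixes f :: "int \<Rightarrow> real"
  assumes sum: "f summable_on UNIV"
    and per: "\<And>j. f (j + d) = f j" and "d \<noteq> 0"
  shows "f j = 0"
proof (rule ccontr)
  assume nz: "f j \<noteq> 0"
  let ?A = "range (\<lambda>n. j + int n * d)"
  have const: "f (j + int n * d) = f j" for n
  proof (induction n)
    case (Suc n)
    then show ?case using per[of "j + int n * d"] by (simp add: algebra_simps)
  qed simp
  have "inj (\<lambda>n. j + int n * d)"
    using \<open>d \<noteq> 0\<close> by (simp add: inj_def)
  then have inf: "infinite ?A"
    by (rule range_inj_infinite)
  have "f summable_on ?A"
    by (rule summable_on_subset_banach[OF sum]) simp
  also have "f summable_on ?A \<longleftrightarrow> (\<lambda>_. f j) summable_on ?A"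
    using const by (intro summable_on_cong) auto
  finally show False
    using infsum_diverge_constant[OF inf nz] by blast
qed

lemma character_zero:
  assumes "\<chi> \<in> characters"
  shows "\<chi> 0 = 1"
proof -
  have "\<chi> (0 + 0) = \<chi> 0 * \<chi> 0" "cmod (\<chi> 0) = 1"
    using assms unfolding characters_def by blast+
  then show ?thesis by (auto simp: mult_cancel_left2)
qed

lemma monoid_ring_mat: "monoid (ring_mat TYPE(complex) p u)"
  by (rule ring.is_monoid) (rule ring_mat)

lemma cyclic_mat_pow:
  assumes "1 \<le> p"
  shows "cyclic_mat p [^]\<^bsub>ring_mat TYPE(complex) p ()\<^esub> (n::nat) =
    Matrix.mat p p (\<lambda>(k, l). if l = (k + n) mod p then 1 else 0)"
proof (induction n)
  case 0
  then show ?case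
    by (simp add: ring_mat_simps nat_pow_def) (rule eq_matI, auto)
next
  case (Suc n)
  interpret monoid "ring_mat TYPE(complex) p ()" by (rule monoid_ring_mat)
  let ?M = "\<lambda>n. Matrix.mat p p (\<lambda>(k, l). if l = (k + n) mod p then 1 else (0::complex))"
  have "?M n * cyclic_mat p = ?M (Suc n)"
  proof (rule eq_matI)
    fix k l assume "k < dim_row (?M (Suc n))" "l < dim_col (?M (Suc n))"
    then have kl: "k < p" "l < p" by simp_all
    have "(?M n * cyclic_mat p) $$ (k, l) =
        (\<Sum>m\<in>{0..<p}. (if m = (k + n) mod p then 1 else 0) * (if l = (m + 1) mod p then 1 else 0))"
      using kl by (simp add: cyclic_mat_def scalar_prod_def)
    also have "\<dots> = (\<Sum>m\<in>{0..<p}. if m = (k + n) mod p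
        then (if l = (m + 1) mod p then 1 else (0::complex)) else 0)"
      by (rule sum.cong) simp_all
    also have "\<dots> = (if l = ((k + n) mod p + 1) mod p then 1 else 0)"
      using assms by simp
    also have "\<dots> = ?M (Suc n) $$ (k, l)"
      using kl by (simp add: mod_Suc_eq)
    finally show "(?M n * cyclic_mat p) $$ (k, l) = ?M (Suc n) $$ (k, l)" .
  qed (simp_all add: cyclic_mat_def)
  then show ?case
    by (simp add: Suc.IH[simplified] ring_mat_simps)
qed

text \<open>
  Negative powers are monoid inverses; these are \<open>p \<times> p\<close> matrices because the cyclic matrix is a
  unit.
\<close>

lemma fin_rep_carrier:
  assumes "1 \<le> p" "\<xi> \<in> carrier_vec p"
  shows "fin_rep \<alpha> \<chi> p g \<xi> \<in> carrier_vec p"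
proof -
  interpret monoid "ring_mat TYPE(complex) p ()" by (rule monoid_ring_mat)
  obtain j b where g: "g = (j, b)" by fastforce
  have "cyclic_mat p [^]\<^bsub>ring_mat TYPE(complex) p ()\<^esub> j \<in> carrier (ring_mat TYPE(complex) p ())"
    using Units_inv_closed[OF Units_pow_closed[OF cyclic_mat_unit[OF assms(1)]]]
      Units_closed[OF cyclic_mat_unit[OF assms(1)]]
    unfolding int_pow_def2 by (simp del: pow_nat)
  then have "fin_rep_mat \<alpha> \<chi> p g \<in> carrier_mat p p"
    by (auto simp: g fin_rep_mat_def diag_rep_def ring_mat_simps
        intro: mult_carrier_mat mat_diag_dim)
  then show ?thesis
    using assms(2) by (simp add: fin_rep_def)
qed

text \<open>
  Going once around the cycle returns every coordinate to its place, and every character is \<open>1\<close> at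
  \<open>0\<close>, so both factors of the matrix of \<open>(p, 0)\<close> are the identity.
\<close>

lemma fin_rep_period:
  assumes "automorphism \<alpha>" "\<chi> \<in> characters" "1 \<le> p" "\<xi> \<in> carrier_vec p"
  shows "fin_rep \<alpha> \<chi> p (int p, 0) \<xi> = \<xi>"
proof -
  have iter: "(\<alpha> ^^ k) 0 = 0" for k
  proof -
    have "int_iter \<alpha> (int k) 0 = 0"
      using int_iter_hom[OF assms(1), of "int k" 0 0] by simp
    then show ?thesis by (simp add: int_iter_def)
  qed
  have D: "diag_rep \<alpha> \<chi> p 0 = 1\<^sub>m p"
    by (rule eq_matI) (auto simp: diag_rep_def mat_diag_def iter character_zero[OF assms(2)])
  have T: "cyclic_mat p [^]\<^bsub>ring_mat TYPE(complex) p ()\<^esub> int p = 1\<^sub>m p"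
    unfolding int_pow_int cyclic_mat_pow[OF assms(3)] by (rule eq_matI) auto
  show ?thesis
    using assms(4) by (simp add: fin_rep_def fin_rep_mat_def D T)
qed

lemma ind_rep_translation:
  assumes "automorphism \<alpha>"
  shows "ind_rep \<alpha> (n, 0) F (j, b) = F (j + n, b)"
  using int_iter_hom[OF assms, of j 0 0]
  by (simp add: ind_rep_def semidirect_int_def)

lemma ind_space_periodic_imp_zero:
  fixes \<chi> :: "'a::ab_group_add \<Rightarrow> complex"
  assumes F: "F \<in> carrier (ind_space \<chi>)"
    and per: "\<And>j. F (j + d, 0) = F (j, 0)" and "d \<noteq> 0"
  shows "F = (\<lambda>_. 0)"
proof (rule ext)
  fix g :: "int \<times> 'a" obtain j b where g: "g = (j, b)" by fastforce
  have cov: "F (j, b) = \<chi> b * F (j, 0)" and sum: "(\<lambda>j. (cmod (F (j, 0)))\<^sup>2) summable_on UNIV"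
    using F unfolding ind_space_def partial_object.simps by blast+
  have "(cmod (F (j, 0)))\<^sup>2 = 0"
    by (rule periodic_summable_imp_zero[OF sum _ \<open>d \<noteq> 0\<close>]) (simp add: per)
  then show "F g = 0" by (simp add: g cov)
qed

lemma zero_op_intertwines:
  assumes "1 \<le> p"
  shows "zero_op (complex_space p) (ind_space \<chi>) \<in> intertwiners (semidirect_int \<alpha>)
    (complex_space p) (fin_rep \<alpha> \<chi> p) (ind_space \<chi>) (ind_rep \<alpha>)"
  by (auto simp: fin_rep_carrier[OF assms] intertwiners_def bounded_linear_ops_def zero_op_def complex_space_def
      ind_space_def ind_rep_def intro!: exI[of _ 0])

theorem theorem7p4:
  fixes \<alpha> :: "'b::ab_group_add \<Rightarrow> 'b" and \<chi> :: "'b \<Rightarrow> complex" and p :: nat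
  assumes "automorphism \<alpha>"
    and "\<chi> \<in> characters"
    and "minimal_period \<alpha> \<chi> p"
  shows "intertwiners (semidirect_int \<alpha>)
           (complex_space p) (fin_rep \<alpha> \<chi> p)
           (ind_space \<chi>) (ind_rep \<alpha>)
         = {zero_op (complex_space p) (ind_space \<chi>)}"
    (is "?L = {?Z}")
proof
  have p: "1 \<le> p"
    using assms(3) by (simp add: minimal_period_def)
  show "{?Z} \<subseteq> ?L"
    using zero_op_intertwines[OF p] by blast
  show "?L \<subseteq> {?Z}"
  proof
    fix A assume A: "A \<in> ?L"
    then have ext: "A \<in> carrier (complex_space p) \<rightarrow>\<^sub>E carrier (ind_space \<chi>)"
      by (simp add: intertwiners_def bounded_linear_ops_def)
    have inter: "A (fin_rep \<alpha> \<chi> p g \<xi>) = ind_rep \<alpha> g (A \<xi>)"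
      if "\<xi> \<in> carrier (complex_space p)" for g \<xi>
      using A that by (cases g) (simp add: intertwiners_def semidirect_int_def)
    have "A \<xi> = (\<lambda>_. 0)" if \<xi>: "\<xi> \<in> carrier (complex_space p)" for \<xi>
    proof (rule ind_space_periodic_imp_zero)
      show "A \<xi> \<in> carrier (ind_space \<chi>)"
        using ext \<xi> by blast
      have "ind_rep \<alpha> (int p, 0) (A \<xi>) = A \<xi>"
        using inter[OF \<xi>, of "(int p, 0)"] \<xi> fin_rep_period[OF assms(1,2) p, of \<xi>]
        by (simp add: complex_space_def)
      then show "A \<xi> (j + int p, 0) = A \<xi> (j, 0)" for j
        by (metis ind_rep_translation[OF assms(1)])
      show "int p \<noteq> 0" using p by simp
    qed
    then have "A = ?Z"
      using ext by (auto simp: zero_op_def ind_space_def PiE_def extensional_def)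
    then show "A \<in> {?Z}" by simp
  qed
qed

end
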